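(* Let $v_0,\ldots,v_3\colon\mathbb{R}^3\to\mathbb{C}$, let $V_i$ be the octonion Fourier transform of $v_i$ ($i=0,\dots,3$), let $u=v_0+v_1\mathbf{e}_2+v_2\mathbf{e}_4+v_3\mathbf{e}_2\mathbf{e}_4$ and let $U_{\mathrm{OFT}}$ be the octonion Fourier transform of $u$. Then for all $(f_1,f_2,f_3)\in\mathbb{R}^3$ $$\begin{aligned}U_{\mathrm{OFT}}(f_1,f_2,f_3)&=V_0(f_1,f_2,f_3)+V_1(-f_1,f_2,-f_3)\cdot\mathbf{e}_2\\&\quad+V_2(-f_1,-f_2,f_3)\cdot\mathbf{e}_4+V_3(f_1,-f_2,-f_3)\cdot\mathbf{e}_2\cdot\mathbf{e}_4.\end{aligned}$$
   Context: $\mathbb{O}$ denotes the real algebra of octonions with basis $1,\mathbf{e}_1,\dots,\mathbf{e}_7$: an octonion is a pair $(q_0,q_1)$ of quaternions (quaternion units $\mathbf{e}_1,\mathbf{e}_2,\mathbf{e}_3$ with $\mathbf{e}_1\mathbf{e}_2=\mathbf{e}_3$), with product $(q_0,q_1)\cdot(p_0,p_1)=(q_0p_0-p_1^*q_1,\;p_1q_0+q_1p_0^* )$, where $^*$ is quaternion conjugation, and $\mathbf{e}_4=(0,1)$, $\mathbf{e}_5=(0,\mathbf{e}_1)$, $\mathbf{e}_6=(0,\mathbf{e}_2)$, $\mathbf{e}_7=(0,\mathbf{e}_3)$. The product is neither commutative nor associative; products without brackets are evaluated from left to right, i.e. $abcd=((ab)c)d$. For an imaginary unit $\mathbf{e}_k$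 and $\alpha\in\mathbb{R}$, $e^{\mathbf{e}_k\alpha}=\cos\alpha+\mathbf{e}_k\sin\alpha$. Integrals of octonion-valued functions are taken componentwise. The octonion Fourier transform (OFT) of a Lebesgue integrable $u\colon\mathbb{R}^3\to\mathbb{O}$ is $$U_{\mathrm{OFT}}(\mathbf{f})=\int_{\mathbb{R}^3}u(\mathbf{x})\,e^{-\mathbf{e}_1 2\pi f_1x_1}\,e^{-\mathbf{e}_2 2\pi f_2x_2}\,e^{-\mathbf{e}_4 2\pi f_3x_3}\,d\mathbf{x},\qquad \mathbf{f}=(f_1,f_2,f_3)\in\mathbb{R}^3,$$ with multiplication from left to right. Here $\mathbb{C}$ is identified with the subfield $\{a+b\mathbf{e}_1: a,b\in\mathbb{R}\}$ of $\mathbb{O}$. Standing assumption: the functions $v_0,\dots,v_3$ are Lebesgue integrable, so that the transforms are well defined. *)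

theory Defs
  imports "HOL-Analysis.Analysis"
begin

section \<open>Quaternions\<close>

datatype quat = Quat (q_re: real) (q_i: real) (q_j: real) (q_k: real)

instantiation quat :: real_algebra_1
begin

definition "0 = Quat 0 0 0 0"
definition "1 = Quat 1 0 0 0"
definition "p + q = Quat (q_re p + q_re q) (q_i p + q_i q) (q_j p + q_j q) (q_k p + q_k q)"
definition "- q = Quat (- q_re q) (- q_i q) (- q_j q) (- q_k q)"
definition "p - q = Quat (q_re p - q_re q) (q_i p - q_i q) (q_j p - q_j q) (q_k p - q_k q)"
definition "r *\<^sub>R q = Quat (r * q_re q) (r * q_i q) (r * q_j q) (r * q_k q)"
definition
  "p * q = Quat
    (q_re p * q_re q - q_i p * q_i q - q_j p * q_j q - q_k p * q_k q)
    (q_re p * q_i q + q_i p * q_re q + q_j p * q_k q - q_k p * q_j q)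
    (q_re p * q_j q - q_i p * q_k q + q_j p * q_re q + q_k p * q_i q)
    (q_re p * q_k q + q_i p * q_j q - q_j p * q_i q + q_k p * q_re q)"

lemmas quat_defs = zero_quat_def one_quat_def plus_quat_def uminus_quat_def minus_quat_def
  scaleR_quat_def times_quat_def

instance
  by standard (auto simp: quat_defs algebra_simps)

end

definition qcnj :: "quat \<Rightarrow> quat" where
  "qcnj q = Quat (q_re q) (- q_i q) (- q_j q) (- q_k q)"


section \<open>Octonions\<close>

datatype octonion = Oct (o_fst: quat) (o_snd: quat)

text \<open>The product is not associative, so the type is made an instance of the syntactic class
  of multiplication only; as \<open>*\<close> associates to the left, a product without brackets
  is evaluated from left to right.\<close>

instantiation octonion :: "{real_vector, one, times}"
begin

definition "0 = Oct 0 0"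
definition "1 = Oct 1 0"
definition "a + b = Oct (o_fst a + o_fst b) (o_snd a + o_snd b)"
definition "- a = Oct (- o_fst a) (- o_snd a)"
definition "a - b = Oct (o_fst a - o_fst b) (o_snd a - o_snd b)"
definition "r *\<^sub>R a = Oct (r *\<^sub>R o_fst a) (r *\<^sub>R o_snd a)"
definition
  "a * b = Oct
    (o_fst a * o_fst b - qcnj (o_snd b) * o_snd a)
    (o_snd b * o_fst a + o_snd a * qcnj (o_fst b))"

lemmas octonion_defs = zero_octonion_def one_octonion_def plus_octonion_def uminus_octonion_def
  minus_octonion_def scaleR_octonion_def times_octonion_def

instance
  by standard (auto simp: octonion_defs algebra_simps)

end

definition oct_e1 :: octonion where "oct_e1 = Oct (Quat 0 1 0 0) 0"
definition oct_e2 :: octonion where "oct_e2 = Oct (Quat 0 0 1 0) 0"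
definition oct_e3 :: octonion where "oct_e3 = Oct (Quat 0 0 0 1) 0"
definition oct_e4 :: octonion where "oct_e4 = Oct 0 1"
definition oct_e5 :: octonion where "oct_e5 = Oct 0 (Quat 0 1 0 0)"
definition oct_e6 :: octonion where "oct_e6 = Oct 0 (Quat 0 0 1 0)"
definition oct_e7 :: octonion where "oct_e7 = Oct 0 (Quat 0 0 0 1)"

lemmas oct_unit_defs = oct_e1_def oct_e2_def oct_e3_def oct_e4_def oct_e5_def oct_e6_def oct_e7_def

lemma oct_unit_products:
  "oct_e1 * oct_e2 = oct_e3"
  "oct_e1 * oct_e4 = oct_e5"
  "oct_e2 * oct_e4 = oct_e6"
  "oct_e3 * oct_e4 = oct_e7"
  by (simp_all add: oct_unit_defs octonion_defs quat_defs qcnj_def)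

lemma oct_unit_squares:
  "e \<in> {oct_e1, oct_e2, oct_e3, oct_e4, oct_e5, oct_e6, oct_e7} \<Longrightarrow> e * e = - 1"
  by (auto simp: oct_unit_defs octonion_defs quat_defs qcnj_def)

definition oct_of_complex :: "complex \<Rightarrow> octonion" where
  "oct_of_complex z = Re z *\<^sub>R 1 + Im z *\<^sub>R oct_e1"

text \<open>The exponential of \<open>\<alpha>\<close> times an imaginary unit \<open>e\<close>.\<close>

definition oct_exp :: "octonion \<Rightarrow> real \<Rightarrow> octonion" where
  "oct_exp e \<alpha> = cos \<alpha> *\<^sub>R 1 + sin \<alpha> *\<^sub>R e"


section \<open>The octonion Fourier transform\<close>

definition oct_integral :: "'a measure \<Rightarrow> ('a \<Rightarrow> octonion) \<Rightarrow> octonion" where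
  "oct_integral M g = Oct
    (Quat (\<integral>x. q_re (o_fst (g x)) \<partial>M) (\<integral>x. q_i (o_fst (g x)) \<partial>M)
          (\<integral>x. q_j (o_fst (g x)) \<partial>M) (\<integral>x. q_k (o_fst (g x)) \<partial>M))
    (Quat (\<integral>x. q_re (o_snd (g x)) \<partial>M) (\<integral>x. q_i (o_snd (g x)) \<partial>M)
          (\<integral>x. q_j (o_snd (g x)) \<partial>M) (\<integral>x. q_k (o_snd (g x)) \<partial>M))"

definition OFT :: "(real ^ 3 \<Rightarrow> octonion) \<Rightarrow> real ^ 3 \<Rightarrow> octonion" where
  "OFT u f = oct_integral lebesgue (\<lambda>x.
     u x * oct_exp oct_e1 (- (2 * pi * f $ 1 * x $ 1))
         * oct_exp oct_e2 (- (2 * pi * f $ 2 * x $ 2))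
         * oct_exp oct_e4 (- (2 * pi * f $ 3 * x $ 3)))"

end

theory Submission
  imports Defs
begin

text \<open>
  The kernel factors multiply the signal from the right, and so do the units \<open>oct_e2\<close> and \<open>oct_e4\<close>
  that build \<open>u\<close> from its complex parts. The idea is to move each such unit \<open>e\<close> to the right of the
  three exponentials. It passes \<open>oct_exp e \<alpha>\<close> unchanged, and it turns \<open>oct_exp e' \<alpha>\<close> into
  \<open>oct_exp e' (- \<alpha>)\<close> for a different unit \<open>e'\<close>, because distinct imaginary units anticommute.
  Associativity is replaced here by the linearised right alternative law
  (\<open>oct_right_alternative\<close>), which says that two right multiplications by anticommuting elements
  anticommute.

  A sign flip of \<open>\<alpha>\<close> in one factor is a sign flip of the corresponding frequency, so the transform
  turns right multiplication by \<open>oct_e2\<close> into the pattern \<open>(-, +, -)\<close> and by \<open>oct_e4\<close> into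
  \<open>(-, -, +)\<close> (\<open>OFT_mult_e2\<close>, \<open>OFT_mult_e4\<close>). Applying both rules gives \<open>(+, -, -)\<close> for
  the last summand of \<open>u\<close>, and linearity of the integral combines the four summands.
\<close>

lemma oct_distrib_right: "(a + b) * c = a * c + b * (c :: octonion)"
  by (simp add: octonion_defs quat_defs qcnj_def algebra_simps)

lemma oct_left_diff_distrib: "(a - b) * c = a * c - b * (c :: octonion)"
  by (simp add: octonion_defs quat_defs qcnj_def algebra_simps)

lemma oct_scaleR_left: "(r *\<^sub>R a) * b = r *\<^sub>R (a * (b :: octonion))"
  by (simp add: octonion_defs quat_defs qcnj_def algebra_simps)

text \<open>Splitting the exponential turns questions about right multiplication by it into questions
  about right multiplication by the fixed unit \<open>e\<close>, with bounded real coefficients.\<close>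

lemma oct_mult_exp: "a * oct_exp e \<alpha> = cos \<alpha> *\<^sub>R a + sin \<alpha> *\<^sub>R (a * e)"
  by (cases a; cases e; cases "o_fst a"; cases "o_snd a")
    (simp add: oct_exp_def octonion_defs quat_defs qcnj_def algebra_simps)

text \<open>Polarising the alternative identity \<open>(a * b) * b = a * (b * b)\<close> in \<open>b\<close> gives the only
  trace of associativity that exchanging right factors requires.\<close>

lemma oct_right_alternative: "a * b * c + a * c * b = a * (b * c + c * (b :: octonion))"
  by (simp add: octonion_defs quat_defs qcnj_def algebra_simps)

lemma oct_mult_anticommute:
  assumes "b * c + c * b = (0 :: octonion)"
  shows "a * b * c = - (a * c * b)"
proof -
  have "a * (0 :: octonion) = 0"
    by (simp add: octonion_defs quat_defs qcnj_def)
  then show ?thesis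
    using oct_right_alternative[of a b c] assms by (simp add: eq_neg_iff_add_eq_0)
qed

lemma oct_mult_exp_commute: "a * e * oct_exp e \<alpha> = a * oct_exp e \<alpha> * e"
  by (simp add: oct_mult_exp oct_distrib_right oct_scaleR_left)

lemma oct_mult_exp_anticommute:
  assumes "e * e' + e' * e = 0"
  shows "a * e * oct_exp e' \<alpha> = a * oct_exp e' (- \<alpha>) * e"
  using oct_mult_anticommute[OF assms, of a]
  by (simp add: oct_mult_exp oct_left_diff_distrib oct_scaleR_left)

lemma oct_units_anticommute:
  "oct_e2 * oct_e1 + oct_e1 * oct_e2 = 0"
  "oct_e2 * oct_e4 + oct_e4 * oct_e2 = 0"
  "oct_e4 * oct_e1 + oct_e1 * oct_e4 = 0"
  "oct_e4 * oct_e2 + oct_e2 * oct_e4 = 0"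
  by (simp_all add: oct_unit_defs octonion_defs quat_defs qcnj_def)

text \<open>In the next two identities one of the three factors belongs to the unit that is moved and
  keeps its phase; the other two phases change sign.\<close>

lemma kernel_mult_e2:
  "a * oct_e2 * oct_exp oct_e1 \<alpha> * oct_exp oct_e2 \<beta> * oct_exp oct_e4 \<gamma> =
   a * oct_exp oct_e1 (- \<alpha>) * oct_exp oct_e2 \<beta> * oct_exp oct_e4 (- \<gamma>) * oct_e2"
  by (simp only: oct_units_anticommute oct_mult_exp_anticommute oct_mult_exp_commute)

lemma kernel_mult_e4:
  "a * oct_e4 * oct_exp oct_e1 \<alpha> * oct_exp oct_e2 \<beta> * oct_exp oct_e4 \<gamma> =
   a * oct_exp oct_e1 (- \<alpha>) * oct_exp oct_e2 (- \<beta>) * oct_exp oct_e4 \<gamma> * oct_e4"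
  by (simp only: oct_units_anticommute oct_mult_exp_anticommute oct_mult_exp_commute)

text \<open>Octonions carry no norm here, so Bochner integrability of \<open>g\<close> itself is not meaningful;
  the condition is imposed on the eight real integrands of \<open>oct_integral\<close>.\<close>

definition oct_integrable :: "'a measure \<Rightarrow> ('a \<Rightarrow> octonion) \<Rightarrow> bool" where
  "oct_integrable M g \<longleftrightarrow>
     (\<forall>c \<in> {q_re, q_i, q_j, q_k}. integrable M (\<lambda>x. c (o_fst (g x))) \<and> integrable M (\<lambda>x. c (o_snd (g x))))"

lemma oct_integrable_add:
  assumes "oct_integrable M g" "oct_integrable M h"
  shows "oct_integrable M (\<lambda>x. g x + h x)"
  using assms by (simp add: oct_integrable_def octonion_defs quat_defs)

lemma oct_integrable_mult_const:
  assumes "oct_integrable M g"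
  shows "oct_integrable M (\<lambda>x. g x * c)"
  using assms by (simp add: oct_integrable_def octonion_defs quat_defs qcnj_def)

lemma oct_integral_add:
  assumes "oct_integrable M g" "oct_integrable M h"
  shows "oct_integral M (\<lambda>x. g x + h x) = oct_integral M g + oct_integral M h"
  using assms by (simp add: oct_integrable_def oct_integral_def octonion_defs quat_defs)

text \<open>Each coordinate of \<open>g x * c\<close> is a fixed real linear combination of the coordinates of
  \<open>g x\<close>.\<close>

lemma oct_integral_mult_const:
  assumes "oct_integrable M g"
  shows "oct_integral M (\<lambda>x. g x * c) = oct_integral M g * c"
  using assms
  by (simp add: oct_integrable_def oct_integral_def octonion_defs quat_defs qcnj_def)

lemma integrable_mult_bounded:
  fixes b f :: "'a \<Rightarrow> real"
  assumes "integrable M f" "b \<in> borel_measurable M" "\<And>x. \<bar>b x\<bar> \<le> 1"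
  shows "integrable M (\<lambda>x. b x * f x)"
proof (rule Bochner_Integration.integrable_bound[OF assms(1)])
  show "(\<lambda>x. b x * f x) \<in> borel_measurable M"
    using assms by measurable
  show "AE x in M. norm (b x * f x) \<le> norm (f x)"
    using assms(3) by (simp add: abs_mult mult_left_le_one_le)
qed

lemma oct_integrable_scaleR_bounded:
  assumes "oct_integrable M g" "b \<in> borel_measurable M" "\<And>x. \<bar>b x\<bar> \<le> 1"
  shows "oct_integrable M (\<lambda>x. b x *\<^sub>R g x)"
  using assms by (simp add: oct_integrable_def octonion_defs quat_defs integrable_mult_bounded)

lemma oct_integrable_mult_exp:
  assumes [measurable]: "\<alpha> \<in> borel_measurable M" and g: "oct_integrable M g"
  shows "oct_integrable M (\<lambda>x. g x * oct_exp e (\<alpha> x))"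
proof -
  have "(\<lambda>x. cos (\<alpha> x)) \<in> borel_measurable M" "(\<lambda>x. sin (\<alpha> x)) \<in> borel_measurable M"
    by measurable
  then show ?thesis
    unfolding oct_mult_exp
    by (intro oct_integrable_add oct_integrable_scaleR_bounded oct_integrable_mult_const
        g abs_cos_le_one abs_sin_le_one)
qed

lemma oct_integrable_of_complex:
  assumes "integrable M v"
  shows "oct_integrable M (\<lambda>x. oct_of_complex (v x))"
  using assms
  by (simp add: oct_integrable_def oct_of_complex_def oct_e1_def octonion_defs quat_defs)

text \<open>This makes the integral defining the transform additive in the signal: a component
  that is not integrable would have the default integral 0, which breaks additivity.\<close>

lemma oct_integrable_OFT_integrand:
  fixes g :: "real ^ 3 \<Rightarrow> octonion"
  assumes "oct_integrable lebesgue g"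
  shows "oct_integrable lebesgue (\<lambda>x. g x * oct_exp oct_e1 (- (2 * pi * f $ 1 * x $ 1))
    * oct_exp oct_e2 (- (2 * pi * f $ 2 * x $ 2))
    * oct_exp oct_e4 (- (2 * pi * f $ 3 * x $ 3)))"
proof -
  have "(\<lambda>x :: real ^ 3. - (2 * pi * r * x $ i)) \<in> borel_measurable lebesgue" for r i
    by (intro measurable_completion) simp
  then show ?thesis
    by (intro oct_integrable_mult_exp assms)
qed

lemma OFT_add:
  assumes "oct_integrable lebesgue g" "oct_integrable lebesgue h"
  shows "OFT (\<lambda>x. g x + h x) f = OFT g f + OFT h f"
  unfolding OFT_def oct_distrib_right
  by (intro oct_integral_add oct_integrable_OFT_integrand assms)

text \<open>The phases are linear in the frequencies, so the sign changes of the kernel can be absorbed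
  into the point at which the transform is evaluated.\<close>

lemma OFT_mult_e2:
  assumes "oct_integrable lebesgue g"
  shows "OFT (\<lambda>x. g x * oct_e2) (vector [f1, f2, f3]) =
         OFT g (vector [- f1, f2, - f3]) * oct_e2"
  unfolding OFT_def kernel_mult_e2
    oct_integral_mult_const[OF oct_integrable_OFT_integrand[OF assms], symmetric]
  by simp

lemma OFT_mult_e4:
  assumes "oct_integrable lebesgue g"
  shows "OFT (\<lambda>x. g x * oct_e4) (vector [f1, f2, f3]) =
         OFT g (vector [- f1, - f2, f3]) * oct_e4"
  unfolding OFT_def kernel_mult_e4
    oct_integral_mult_const[OF oct_integrable_OFT_integrand[OF assms], symmetric]
  by simp

theorem corollary1:
  fixes v0 v1 v2 v3 :: "real ^ 3 \<Rightarrow> complex"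
    and V0 V1 V2 V3 u U :: "real ^ 3 \<Rightarrow> octonion"
  assumes "integrable lebesgue v0"
    and "integrable lebesgue v1"
    and "integrable lebesgue v2"
    and "integrable lebesgue v3"
    and "V0 = OFT (\<lambda>x. oct_of_complex (v0 x))"
    and "V1 = OFT (\<lambda>x. oct_of_complex (v1 x))"
    and "V2 = OFT (\<lambda>x. oct_of_complex (v2 x))"
    and "V3 = OFT (\<lambda>x. oct_of_complex (v3 x))"
    and "u = (\<lambda>x. oct_of_complex (v0 x) + oct_of_complex (v1 x) * oct_e2
                 + oct_of_complex (v2 x) * oct_e4 + oct_of_complex (v3 x) * oct_e2 * oct_e4)"
    and "U = OFT u"
  shows "\<forall>f1 f2 f3 :: real.
           U (vector [f1, f2, f3]) =
             V0 (vector [f1, f2, f3]) + V1 (vector [- f1, f2, - f3]) * oct_e2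
             + V2 (vector [- f1, - f2, f3]) * oct_e4
             + V3 (vector [f1, - f2, - f3]) * oct_e2 * oct_e4"
proof (intro allI)
  fix f1 f2 f3 :: real
  note int = assms(1-4)[THEN oct_integrable_of_complex]
  have "U (vector [f1, f2, f3]) =
      OFT (\<lambda>x. oct_of_complex (v0 x)) (vector [f1, f2, f3])
      + OFT (\<lambda>x. oct_of_complex (v1 x) * oct_e2) (vector [f1, f2, f3])
      + OFT (\<lambda>x. oct_of_complex (v2 x) * oct_e4) (vector [f1, f2, f3])
      + OFT (\<lambda>x. oct_of_complex (v3 x) * oct_e2 * oct_e4) (vector [f1, f2, f3])"
    unfolding assms(9,10) by (simp only: OFT_add oct_integrable_add oct_integrable_mult_const int)
  \<comment> \<open>The summand with two units loses \<open>oct_e4\<close> first, at \<open>(-, -, +)\<close>, and then \<open>oct_e2\<close>;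
    \<open>minus_minus\<close> restores the sign of the first frequency.\<close>
  then show "U (vector [f1, f2, f3]) =
      V0 (vector [f1, f2, f3]) + V1 (vector [- f1, f2, - f3]) * oct_e2
      + V2 (vector [- f1, - f2, f3]) * oct_e4
      + V3 (vector [f1, - f2, - f3]) * oct_e2 * oct_e4"
    unfolding assms(5-8)
    by (simp only: OFT_mult_e2 OFT_mult_e4 oct_integrable_mult_const int minus_minus)
qed

end
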